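(* Let $N\ge 1$ be an integer, $n\in\{0,\dots,N\}$ and $\alpha<1$. Consider the system for $u=u_{5,10^b}(t)$, $v=v_{5,10^b}(t)$ (with $'=d/dt$) $$u'=\frac{u\left(2nNv-N^2+(N+1)v^2(-\alpha+N+1)\right)+Nu^2v\left(v(\alpha+n-2N-2)-2N\right)+nN}{Nt\,v\,(uv+1)},$$ $$v'=-\frac{N^2+v^2\left((N+1)(-\alpha+N+1)+2Ntu\right)+Ntu^2v^3+Nv(-\alpha+2N+t+2)}{Nt\,(uv+1)}.$$ (1) The birational transformation $$\hat\psi_{1,1}:\ u_{5,10^b}=V_{1,1},\qquad \frac{1}{v_{5,10^b}}=U_{1,1}V_{1,1}$$ transforms this system into $$U_{1,1}'=\frac{U_{1,1}(-\alpha-n+2N+t+2)-U_{1,1}^2(n-2NV_{1,1})+t}{t},$$ $$V_{1,1}'=\frac{NV_{1,1}\left(U_{1,1}(U_{1,1}+2)(n-NV_{1,1})+\alpha+n-2N-2\right)+(N+1)(-\alpha+N+1)}{Nt(U_{1,1}+1)}.$$ (2) Define the following birational maps (from new to old coordinates, depending on the parameter $t\neq 0$): $$\hat\phi_{1,1}:(U_{1,1},V_{1,1})\mapsto(q,p)=(V_{1,1},U_{1,1}V_{1,1}),\qquad \phi_{Q,P}:(Q,P)\mapsto(q,p)=(1/Q,1/P),$$ $$\Phi_{5,4^b}:(u_{5,4^b},v_{5,4^b})\mapsto(Q,P),\quad Q=\frac{t\,v_{5,4^b}^2}{v_{5,4^b}\left(\alpha+n-2N+t\,u_{5,4^b}v_{5,4^b}-t-1\right)-N},\quad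 P=v_{5,4^b},$$ $$\phi_{5,5^b}:(u_{5,5^b},v_{5,5^b})\mapsto(u_{5,4^b},v_{5,4^b})=\left(u_{5,5^b}v_{5,5^b},\,1/v_{5,5^b}\right),$$ $$\phi_{5,6^b}:(u_{5,6^b},v_{5,6^b})\mapsto(u_{5,5^b},v_{5,5^b})=\left(u_{5,6^b}v_{5,6^b},\,1/v_{5,6^b}\right),$$ $$\Phi_{5,10^b}:(u_{5,10^b},v_{5,10^b})\mapsto(u_{5,6^b},v_{5,6^b}),\quad \frac{1}{u_{5,6^b}}=\frac{t\,v_{5,10^b}^2}{v_{5,10^b}\left(-\alpha-n+2N+t\,u_{5,10^b}v_{5,10^b}+t+1\right)+N},\quad v_{5,6^b}=v_{5,10^b},$$ and regard $\hat\psi_{1,1}$ as the map $(U_{1,1},V_{1,1})\mapsto(u_{5,10^b},v_{5,10^b})$. Then, as birational maps, $$\hat\phi_{1,1}=\phi_{Q,P}\circ\Phi_{5,4^b}\circ\phi_{5,5^b}\circ\phi_{5,6^b}\circ\Phi_{5,10^b}\circ\hat\psi_{1,1},$$ where $\circ$ is ordinary composition of maps (the rightmost map is applied first).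
   Context: A change of dependent variables $(u,v)=\Psi(U,V)$ (possibly depending on $t$) "transforms" one system of first-order ODEs into another if substituting it into the first system and solving for $U',V'$ gives the second system, as an identity of rational functions in $U,V,t$. Two birational maps are equal if they agree as pairs of rational functions. *)

theory Defs
  imports "HOL-Computational_Algebra.Computational_Algebra"
begin

section \<open>Rational functions in two variables over a field\<close>

text \<open>
  The field of rational functions in two variables over the coefficient field \<open>'f\<close> is the
  fraction field of \<open>'f[x][y]\<close>. The inner variable \<open>x\<close> is the first one. Rational functions that
  depend on a further variable \<open>t\<close> are obtained by taking for \<open>'f\<close> the field
  \<open>'k(t)\<close>, that is \<open>'k poly fract\<close>, since \<open>'k(t)(x,y) = 'k(x,y,t)\<close>.
\<close>

type_synonym 'f ratfun = "'f poly poly fract"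

definition rf_const :: "'f::field \<Rightarrow> 'f ratfun" where
  "rf_const c = to_fract [:[:c:]:]"

definition rf_X :: "'f::field ratfun" where
  "rf_X = to_fract [:[:0, 1:]:]"

definition rf_Y :: "'f::field ratfun" where
  "rf_Y = to_fract [:0, 1:]"

definition poly2_eval :: "'f::field poly poly \<Rightarrow> 'f ratfun \<Rightarrow> 'f ratfun \<Rightarrow> 'f ratfun" where
  "poly2_eval p a b = poly (map_poly (\<lambda>c. poly (map_poly rf_const c) a) p) b"

text \<open>
  Substituting \<open>(a, b)\<close> for the two variables in \<open>r\<close> is possible if \<open>r\<close> can be written as a
  fraction whose denominator does not vanish identically after the substitution. The result
  does not depend on the choice of this fraction, see \<open>rf_subst_eqI\<close> below.
\<close>

definition rf_subst_ok :: "'f::field ratfun \<Rightarrow> 'f ratfun \<Rightarrow> 'f ratfun \<Rightarrow> bool" where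
  "rf_subst_ok r a b \<longleftrightarrow> (\<exists>p q. r = Fract p q \<and> poly2_eval q a b \<noteq> 0)"

definition rf_subst :: "'f::field ratfun \<Rightarrow> 'f ratfun \<Rightarrow> 'f ratfun \<Rightarrow> 'f ratfun" where
  "rf_subst r a b = (THE s. \<exists>p q. r = Fract p q \<and> poly2_eval q a b \<noteq> 0 \<and>
     s = poly2_eval p a b / poly2_eval q a b)"


section \<open>Rational and birational maps of the plane\<close>

type_synonym 'f ratmap = "'f ratfun \<times> 'f ratfun"

definition rm_id :: "'f::field ratmap" where
  "rm_id = (rf_X, rf_Y)"

definition rm_comp_ok :: "'f::field ratmap \<Rightarrow> 'f ratmap \<Rightarrow> bool" where
  "rm_comp_ok f g \<longleftrightarrow> rf_subst_ok (fst f) (fst g) (snd g) \<and> rf_subst_ok (snd f) (fst g) (snd g)"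

text \<open>
  The composition \<open>f \<circ>\<^sub>r g\<close> (first \<open>g\<close>, then \<open>f\<close>) is only meaningful if \<open>rm_comp_ok f g\<close>. This
  always holds if \<open>g\<close> is birational, since then the two components of \<open>g\<close> are algebraically
  independent.
\<close>

definition rm_comp :: "'f::field ratmap \<Rightarrow> 'f ratmap \<Rightarrow> 'f ratmap"  (infixr "\<circ>\<^sub>r" 55) where
  "f \<circ>\<^sub>r g = (rf_subst (fst f) (fst g) (snd g), rf_subst (snd f) (fst g) (snd g))"

definition birational :: "'f::field ratmap \<Rightarrow> bool" where
  "birational f \<longleftrightarrow> (\<exists>g. rm_comp_ok f g \<and> rm_comp_ok g f \<and> f \<circ>\<^sub>r g = rm_id \<and> g \<circ>\<^sub>r f = rm_id)"


section \<open>Derivatives of rational functions and change of dependent variables\<close>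

text \<open>
  Extension of a derivation \<open>d\<close> from an integral domain to its fraction field by the quotient
  rule. It does not depend on the chosen fraction, see \<open>fract_deriv_Fract\<close> below.
\<close>

definition fract_deriv :: "('a::idom \<Rightarrow> 'a) \<Rightarrow> 'a fract \<Rightarrow> 'a fract" where
  "fract_deriv d r = (let (a, b) = (SOME (a, b). b \<noteq> 0 \<and> r = Fract a b)
     in Fract (d a * b - a * d b) (b * b))"

definition rf_dX :: "'f::field ratfun \<Rightarrow> 'f ratfun" where
  "rf_dX = fract_deriv (map_poly pderiv)"

definition rf_dY :: "'f::field ratfun \<Rightarrow> 'f ratfun" where
  "rf_dY = fract_deriv pderiv"

definition fract_dt :: "'k::field poly fract \<Rightarrow> 'k poly fract" where
  "fract_dt = fract_deriv pderiv"

definition rf_dt :: "'k::field poly fract ratfun \<Rightarrow> 'k poly fract ratfun" where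
  "rf_dt = fract_deriv (map_poly (map_poly fract_dt))"

text \<open>
  A system \<open>u' = F\<^sub>1(u,v,t)\<close>, \<open>v' = F\<^sub>2(u,v,t)\<close> of differential equations is represented by the
  pair \<open>F = (F\<^sub>1, F\<^sub>2)\<close> over the coefficient field \<open>'k(t)\<close>. Inserting \<open>(u,v) = \<Psi>(U,V,t)\<close>
  gives, by the chain rule, two equations that are linear in \<open>U'\<close> and \<open>V'\<close>; solving them for
  \<open>U'\<close> and \<open>V'\<close> has to give exactly the system \<open>G\<close>.
\<close>

definition transforms ::
  "'k::field poly fract ratmap \<Rightarrow> 'k poly fract ratmap \<Rightarrow> 'k poly fract ratmap \<Rightarrow> bool" where
  "transforms \<Psi> F G \<longleftrightarrow> rm_comp_ok F \<Psi> \<and>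
     (\<forall>U' V'.
        (rf_dX (fst \<Psi>) * U' + rf_dY (fst \<Psi>) * V' + rf_dt (fst \<Psi>) = fst (F \<circ>\<^sub>r \<Psi>) \<and>
         rf_dX (snd \<Psi>) * U' + rf_dY (snd \<Psi>) * V' + rf_dt (snd \<Psi>) = snd (F \<circ>\<^sub>r \<Psi>))
        \<longleftrightarrow> (U', V') = G)"


section \<open>The two systems\<close>

text \<open>
  Here \<open>\<alpha>\<close> and \<open>t\<close> are elements of the coefficient field; for a differential equation in \<open>t\<close>,
  the coefficient field is \<open>'k(t)\<close> and \<open>t\<close> its generator.
\<close>

definition sys_5_10b :: "nat \<Rightarrow> nat \<Rightarrow> 'f::field \<Rightarrow> 'f \<Rightarrow> 'f ratmap" where
  "sys_5_10b N\<^sub>0 n\<^sub>0 \<alpha>\<^sub>0 t\<^sub>0 =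
     (let N = of_nat N\<^sub>0; n = of_nat n\<^sub>0; \<alpha> = rf_const \<alpha>\<^sub>0; t = rf_const t\<^sub>0; u = rf_X; v = rf_Y in
      ((u * (2 * n * N * v - N^2 + (N + 1) * v^2 * (- \<alpha> + N + 1))
          + N * u^2 * v * (v * (\<alpha> + n - 2 * N - 2) - 2 * N) + n * N)
        / (N * t * v * (u * v + 1)),
       - ((N^2 + v^2 * ((N + 1) * (- \<alpha> + N + 1) + 2 * N * t * u)
            + N * t * u^2 * v^3 + N * v * (- \<alpha> + 2 * N + t + 2))
          / (N * t * (u * v + 1)))))"

definition sys_1_1 :: "nat \<Rightarrow> nat \<Rightarrow> 'f::field \<Rightarrow> 'f \<Rightarrow> 'f ratmap" where
  "sys_1_1 N\<^sub>0 n\<^sub>0 \<alpha>\<^sub>0 t\<^sub>0 =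
     (let N = of_nat N\<^sub>0; n = of_nat n\<^sub>0; \<alpha> = rf_const \<alpha>\<^sub>0; t = rf_const t\<^sub>0; U = rf_X; V = rf_Y in
      ((U * (- \<alpha> - n + 2 * N + t + 2) - U^2 * (n - 2 * N * V) + t) / t,
       (N * V * (U * (U + 2) * (n - N * V) + \<alpha> + n - 2 * N - 2) + (N + 1) * (- \<alpha> + N + 1))
        / (N * t * (U + 1))))"


section \<open>The birational maps\<close>

definition psi_hat_1_1 :: "'f::field ratmap" where
  "psi_hat_1_1 = (let U = rf_X; V = rf_Y in (V, 1 / (U * V)))"

definition phi_hat_1_1 :: "'f::field ratmap" where
  "phi_hat_1_1 = (let U = rf_X; V = rf_Y in (V, U * V))"

definition phi_Q_P :: "'f::field ratmap" where
  "phi_Q_P = (let Q = rf_X; P = rf_Y in (1 / Q, 1 / P))"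

definition Phi_5_4b :: "nat \<Rightarrow> nat \<Rightarrow> 'f::field \<Rightarrow> 'f \<Rightarrow> 'f ratmap" where
  "Phi_5_4b N\<^sub>0 n\<^sub>0 \<alpha>\<^sub>0 t\<^sub>0 =
     (let N = of_nat N\<^sub>0; n = of_nat n\<^sub>0; \<alpha> = rf_const \<alpha>\<^sub>0; t = rf_const t\<^sub>0; u = rf_X; v = rf_Y in
      (t * v^2 / (v * (\<alpha> + n - 2 * N + t * u * v - t - 1) - N), v))"

definition phi_5_5b :: "'f::field ratmap" where
  "phi_5_5b = (let u = rf_X; v = rf_Y in (u * v, 1 / v))"

definition phi_5_6b :: "'f::field ratmap" where
  "phi_5_6b = (let u = rf_X; v = rf_Y in (u * v, 1 / v))"

definition Phi_5_10b :: "nat \<Rightarrow> nat \<Rightarrow> 'f::field \<Rightarrow> 'f \<Rightarrow> 'f ratmap" where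
  "Phi_5_10b N\<^sub>0 n\<^sub>0 \<alpha>\<^sub>0 t\<^sub>0 =
     (let N = of_nat N\<^sub>0; n = of_nat n\<^sub>0; \<alpha> = rf_const \<alpha>\<^sub>0; t = rf_const t\<^sub>0; u = rf_X; v = rf_Y in
      (1 / (t * v^2 / (v * (- \<alpha> - n + 2 * N + t * u * v + t + 1) + N)), v))"


section \<open>Well-definedness\<close>

lemma rf_const_simps [simp]:
  "rf_const 0 = 0" "rf_const 1 = 1"
  "rf_const (a + b) = rf_const a + rf_const b"
  "rf_const (a * b) = rf_const a * rf_const b"
  by (simp_all add: rf_const_def pCons_one flip: to_fract_add to_fract_mult)

lemma poly_map_rf_const_add:
  "poly (map_poly rf_const (p + q)) a = poly (map_poly rf_const p) a + poly (map_poly rf_const q) a"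
  by (subst poly_eqI[of "map_poly rf_const (p + q)" "map_poly rf_const p + map_poly rf_const q"])
     (simp_all add: coeff_map_poly)

lemma poly_map_rf_const_mult:
  "poly (map_poly rf_const (p * q)) a = poly (map_poly rf_const p) a * poly (map_poly rf_const q) a"
proof (induction p)
  case (pCons c p)
  have "map_poly rf_const (smult c q) = smult (rf_const c) (map_poly rf_const q)"
    by (intro poly_eqI) (simp add: coeff_map_poly)
  with pCons show ?case
    by (simp add: poly_map_rf_const_add map_poly_pCons algebra_simps)
qed simp

lemma poly2_eval_0 [simp]: "poly2_eval 0 a b = 0"
  by (simp add: poly2_eval_def)

lemma poly2_eval_pCons:
  "poly2_eval (pCons c p) a b = poly (map_poly rf_const c) a + b * poly2_eval p a b"
  by (simp add: poly2_eval_def map_poly_pCons)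

lemma poly2_eval_add: "poly2_eval (p + q) a b = poly2_eval p a b + poly2_eval q a b"
proof -
  let ?h = "\<lambda>c. poly (map_poly rf_const c) a"
  have "map_poly ?h (p + q) = map_poly ?h p + map_poly ?h q"
    by (intro poly_eqI) (simp add: coeff_map_poly poly_map_rf_const_add)
  then show ?thesis
    by (simp add: poly2_eval_def)
qed

lemma poly2_eval_mult: "poly2_eval (p * q) a b = poly2_eval p a b * poly2_eval q a b"
proof (induction p)
  case (pCons c p)
  let ?h = "\<lambda>c. poly (map_poly rf_const c) a"
  have "map_poly ?h (smult c q) = smult (?h c) (map_poly ?h q)"
    by (intro poly_eqI) (simp add: coeff_map_poly poly_map_rf_const_mult)
  then have "poly2_eval (smult c q) a b = ?h c * poly2_eval q a b"
    by (simp add: poly2_eval_def)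
  with pCons show ?case
    by (simp add: poly2_eval_add poly2_eval_pCons algebra_simps)
qed simp

lemma rf_subst_eqI:
  assumes "r = Fract p q" "poly2_eval q a b \<noteq> 0"
  shows "rf_subst r a b = poly2_eval p a b / poly2_eval q a b"
  unfolding rf_subst_def
proof (rule the_equality)
  fix s assume "\<exists>p q. r = Fract p q \<and> poly2_eval q a b \<noteq> 0 \<and> s = poly2_eval p a b / poly2_eval q a b"
  then obtain p' q' where *: "r = Fract p' q'" "poly2_eval q' a b \<noteq> 0"
      "s = poly2_eval p' a b / poly2_eval q' a b"
    by blast
  then have "q \<noteq> 0" "q' \<noteq> 0"
    using assms(2) by auto
  then have "p * q' = p' * q"
    using assms(1) *(1) by (simp add: eq_fract)
  then have "poly2_eval p a b * poly2_eval q' a b = poly2_eval p' a b * poly2_eval q a b"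
    by (simp flip: poly2_eval_mult)
  then show "s = poly2_eval p a b / poly2_eval q a b"
    using * assms(2) by (simp add: frac_eq_eq)
qed (use assms in blast)

lemma fract_deriv_Fract:
  assumes mult: "\<And>x y. d (x * y) = d x * y + x * d y" and "b \<noteq> 0"
  shows "fract_deriv d (Fract a b) = Fract (d a * b - a * d b) (b * b)"
proof -
  define z where "z = (SOME (a', b'). b' \<noteq> 0 \<and> Fract a b = Fract a' b')"
  obtain a' b' where z: "z = (a', b')"
    by fastforce
  have "case z of (a', b') \<Rightarrow> b' \<noteq> 0 \<and> Fract a b = Fract a' b'"
    unfolding z_def by (rule someI[where x = "(a, b)"]) (simp add: \<open>b \<noteq> 0\<close>)
  then have b': "b' \<noteq> 0" and eq: "a * b' = a' * b"
    using \<open>b \<noteq> 0\<close> by (auto simp: z eq_fract)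
  have "d a * b' + a * d b' = d a' * b + a' * d b"
    using arg_cong[OF eq, of d] by (simp add: mult)
  then have "(d a' * b' - a' * d b') * (b * b) = (d a * b - a * d b) * (b' * b')"
    using eq by algebra
  then show ?thesis
    unfolding fract_deriv_def z_def[symmetric] z using b' \<open>b \<noteq> 0\<close>
    by (simp add: eq_fract)
qed

definition derivation :: "('a::comm_ring_1 \<Rightarrow> 'a) \<Rightarrow> bool" where
  "derivation d \<longleftrightarrow> (\<forall>x y. d (x + y) = d x + d y \<and> d (x * y) = d x * y + x * d y)"

lemma derivation_pderiv: "derivation (pderiv :: 'a::idom poly \<Rightarrow> 'a poly)"
  by (simp add: derivation_def pderiv_add pderiv_mult algebra_simps)

lemma derivation_map_poly:
  assumes "derivation d"
  shows "derivation (map_poly d)"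
proof -
  have add: "d (x + y) = d x + d y" and mult: "d (x * y) = d x * y + x * d y" for x y
    using assms by (auto simp: derivation_def)
  have 0: "d 0 = 0"
    using add[of 0 0] by simp
  have Add: "map_poly d (p + q) = map_poly d p + map_poly d q" for p q
    by (intro poly_eqI) (simp add: coeff_map_poly 0 add)
  have Smult: "map_poly d (smult c q) = smult (d c) q + smult c (map_poly d q)" for c q
    by (intro poly_eqI) (simp add: coeff_map_poly 0 mult)
  have "map_poly d (p * q) = map_poly d p * q + p * map_poly d q" for p q
  proof (induction p)
    case (pCons c p)
    have *: "map_poly d (pCons c r) = pCons (d c) (map_poly d r)" for c r
      by (intro poly_eqI) (simp add: coeff_map_poly 0 coeff_pCons split: nat.split)
    show ?case
      by (simp add: Add Smult * 0 pCons.IH algebra_simps)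
  qed simp
  with Add show ?thesis
    by (simp add: derivation_def)
qed

lemma derivation_fract_deriv:
  assumes "derivation d"
  shows "derivation (fract_deriv d)"
proof -
  have add: "d (x + y) = d x + d y" and mult: "d (x * y) = d x * y + x * d y" for x y
    using assms by (auto simp: derivation_def)
  note * = fract_deriv_Fract[of d, OF mult]
  have "fract_deriv d (x + y) = fract_deriv d x + fract_deriv d y \<and>
        fract_deriv d (x * y) = fract_deriv d x * y + x * fract_deriv d y" for x y
  proof (cases x, cases y)
    fix a b a' b' assume x: "x = Fract a b" "b \<noteq> 0" and y: "y = Fract a' b'" "b' \<noteq> 0"
    then show ?thesis
      by (simp add: * eq_fract add mult) (simp add: algebra_simps)
  qed
  then show ?thesis
    by (simp add: derivation_def)
qed

lemma derivation_partials:
  "derivation rf_dX" "derivation rf_dY" "derivation rf_dt"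
  unfolding rf_dX_def rf_dY_def rf_dt_def fract_dt_def
  by (intro derivation_fract_deriv derivation_map_poly derivation_pderiv)+

end

theory Submission
  imports Defs
begin

text \<open>
  The composition collapses because \<open>Phi_5_10b\<close> is a shear \<open>(u + h(v), v)\<close> and \<open>Phi_5_4b\<close> is
  \<open>(1 / (u - h(v)), v)\<close> with one and the same rational function \<open>h\<close> (\<open>shift\<close> below), that is, the
  inverse shear followed by inversion of \<open>u\<close>. Between them stand \<open>phi_5_5b\<close> and \<open>phi_5_6b\<close>, which
  are both the involution \<open>(u v, 1/v)\<close> and so cancel. The shears then cancel as well, and what
  remains is \<open>(1/u, v)\<close>. Followed by \<open>(1/Q, 1/P)\<close> it gives \<open>(u, 1/v)\<close>, which is \<open>(V, U V)\<close> by the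
  definition of \<open>psi_hat_1_1\<close> (\<open>phi_hat_1_1_decomposition\<close>). Each factor is birational with an
  explicit inverse.

  For the systems, the equations obtained from \<open>u = V\<close>, \<open>v = 1/(U V)\<close> are triangular: the first one
  reads \<open>V' = \<dots>\<close> and the second one determines \<open>U'\<close> from it. Hence the transformation amounts
  to two identities in a field (\<open>sys_5_10b_at_psi\<close>) and to the partial derivatives of
  \<open>1/(U V)\<close> (\<open>partials_psi\<close>, \<open>transforms_psi_hat_1_1\<close>).

  Compositions are computed by a relation \<open>rf_subst_to\<close> that says at once that a substitution is
  possible and what its result is. It is closed under the field operations, so the value of a
  composition is found by following the shape of the expression; the only conditions that
  remain are that denominators do not vanish.
\<close>

section \<open>Evaluating substitutions\<close>

definition rf_subst_to :: "'f::field ratfun \<Rightarrow> 'f ratfun \<Rightarrow> 'f ratfun \<Rightarrow> 'f ratfun \<Rightarrow> bool" where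
  "rf_subst_to a b r s \<longleftrightarrow>
     (\<exists>p q. r = Fract p q \<and> poly2_eval q a b \<noteq> 0 \<and> s = poly2_eval p a b / poly2_eval q a b)"

lemma rf_subst_to_imp_ok: "rf_subst_to a b r s \<Longrightarrow> rf_subst_ok r a b"
  by (auto simp: rf_subst_to_def rf_subst_ok_def)

lemma rf_subst_to_imp_eq: "rf_subst_to a b r s \<Longrightarrow> rf_subst r a b = s"
  unfolding rf_subst_to_def using rf_subst_eqI by blast

lemma poly2_eval_const [simp]: "poly2_eval [:[:c:]:] a b = rf_const c"
  by (cases "c = 0") (simp_all add: poly2_eval_pCons map_poly_pCons)

lemma poly2_eval_1 [simp]: "poly2_eval 1 a b = 1"
  using poly2_eval_const[of 1] by (simp add: pCons_one)

lemma poly2_eval_uminus: "poly2_eval (- p) a b = - poly2_eval p a b"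
  using poly2_eval_add[of p "- p" a b] by (simp add: eq_neg_iff_add_eq_0 add.commute)

lemma rf_subst_to_poly: "rf_subst_to a b (to_fract p) (poly2_eval p a b)"
  unfolding rf_subst_to_def to_fract_def by (intro exI[of _ p] exI[of _ 1]) simp

lemma rf_subst_to_const: "rf_subst_to a b (rf_const c) (rf_const c)"
  using rf_subst_to_poly[of a b "[:[:c:]:]"] by (simp add: rf_const_def[symmetric])

lemma rf_subst_to_X: "rf_subst_to a b rf_X a"
  using rf_subst_to_poly[of a b "[:[:0, 1:]:]"]
  by (simp add: rf_X_def poly2_eval_pCons map_poly_pCons)

lemma rf_subst_to_Y: "rf_subst_to a b rf_Y b"
  using rf_subst_to_poly[of a b "[:0, 1:]"]
  by (simp add: rf_Y_def poly2_eval_pCons map_poly_pCons)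

lemma rf_subst_to_add:
  assumes "rf_subst_to a b r s" "rf_subst_to a b r' s'"
  shows "rf_subst_to a b (r + r') (s + s')"
proof -
  from assms obtain p q p' q' where
    r: "r = Fract p q" "poly2_eval q a b \<noteq> 0" "s = poly2_eval p a b / poly2_eval q a b" and
    r': "r' = Fract p' q'" "poly2_eval q' a b \<noteq> 0" "s' = poly2_eval p' a b / poly2_eval q' a b"
    unfolding rf_subst_to_def by blast
  then have "q \<noteq> 0" "q' \<noteq> 0"
    by auto
  with r r' show ?thesis
    unfolding rf_subst_to_def
    by (intro exI[of _ "p * q' + p' * q"] exI[of _ "q * q'"])
       (simp add: poly2_eval_add poly2_eval_mult add_frac_eq)
qed

lemma rf_subst_to_mult:
  assumes "rf_subst_to a b r s" "rf_subst_to a b r' s'"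
  shows "rf_subst_to a b (r * r') (s * s')"
proof -
  from assms obtain p q p' q' where
    r: "r = Fract p q" "poly2_eval q a b \<noteq> 0" "s = poly2_eval p a b / poly2_eval q a b" and
    r': "r' = Fract p' q'" "poly2_eval q' a b \<noteq> 0" "s' = poly2_eval p' a b / poly2_eval q' a b"
    unfolding rf_subst_to_def by blast
  then show ?thesis
    unfolding rf_subst_to_def
    by (intro exI[of _ "p * p'"] exI[of _ "q * q'"]) (simp add: poly2_eval_mult)
qed

lemma rf_subst_to_uminus:
  assumes "rf_subst_to a b r s"
  shows "rf_subst_to a b (- r) (- s)"
  using rf_subst_to_mult[OF rf_subst_to_poly[of a b "- 1"] assms]
  by (simp add: poly2_eval_uminus to_fract_uminus)

text \<open>
  The numerator of a representation of \<open>r\<close> becomes the denominator of one of \<open>1/r\<close>, so it has to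
  survive the substitution; this is the only operation that restricts the substitution.
\<close>

lemma rf_subst_to_inverse:
  assumes "rf_subst_to a b r s" "s \<noteq> 0"
  shows "rf_subst_to a b (inverse r) (inverse s)"
proof -
  from assms obtain p q where
    r: "r = Fract p q" "poly2_eval q a b \<noteq> 0" "s = poly2_eval p a b / poly2_eval q a b"
    unfolding rf_subst_to_def by blast
  with assms(2) show ?thesis
    unfolding rf_subst_to_def by (intro exI[of _ q] exI[of _ p]) simp
qed

lemma rf_subst_to_diff:
  assumes "rf_subst_to a b r s" "rf_subst_to a b r' s'"
  shows "rf_subst_to a b (r - r') (s - s')"
  using rf_subst_to_add[OF assms(1) rf_subst_to_uminus[OF assms(2)]] by simp

lemma rf_subst_to_divide:
  assumes "rf_subst_to a b r s" "rf_subst_to a b r' s'" "s' \<noteq> 0"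
  shows "rf_subst_to a b (r / r') (s / s')"
  using rf_subst_to_mult[OF assms(1) rf_subst_to_inverse[OF assms(2,3)]] by (simp add: divide_inverse)

lemma rf_subst_to_0: "rf_subst_to a b 0 0" and rf_subst_to_1: "rf_subst_to a b 1 1"
  using rf_subst_to_const[of a b 0] rf_subst_to_const[of a b 1] by simp_all

lemma rf_subst_to_power:
  "rf_subst_to a b r s \<Longrightarrow> rf_subst_to a b (r ^ m) (s ^ m)"
  by (induction m) (simp_all add: rf_subst_to_1 rf_subst_to_mult)

lemma rf_subst_to_of_nat: "rf_subst_to a b (of_nat m) (of_nat m)"
  by (induction m) (simp_all add: rf_subst_to_0 rf_subst_to_1 rf_subst_to_add)

lemma rf_subst_to_numeral: "rf_subst_to a b (numeral w) (numeral w)"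
  using rf_subst_to_of_nat[of a b "numeral w"] by simp

lemmas rf_subst_to_intros =
  rf_subst_to_const rf_subst_to_X rf_subst_to_Y rf_subst_to_0 rf_subst_to_1 rf_subst_to_of_nat
  rf_subst_to_numeral rf_subst_to_add rf_subst_to_diff rf_subst_to_uminus rf_subst_to_mult
  rf_subst_to_power rf_subst_to_divide

text \<open>
  The equations \<open>s = c\<close> and \<open>s' = d\<close> are separate premises because \<open>rf_subst_to_intros\<close> fixes the
  literal form of \<open>s\<close> and \<open>s'\<close>, whereas \<open>c\<close> and \<open>d\<close> are the simplified components of the composition.
\<close>

lemma rm_compI:
  assumes "rf_subst_to a b r s" "rf_subst_to a b r' s'" "s = c" "s' = d"
  shows "rm_comp_ok (r, r') (a, b) \<and> (r, r') \<circ>\<^sub>r (a, b) = (c, d)"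
  using assms by (auto simp: rm_comp_ok_def rm_comp_def dest: rf_subst_to_imp_ok rf_subst_to_imp_eq)

lemma birationalI:
  assumes "rm_comp_ok f g \<and> f \<circ>\<^sub>r g = (rf_X, rf_Y)" "rm_comp_ok g f \<and> g \<circ>\<^sub>r f = (rf_X, rf_Y)"
  shows "birational f"
  using assms unfolding birational_def rm_id_def by blast


section \<open>Rational functions that do not vanish\<close>

text \<open>
  Specialisation detects nonzero rational functions, which avoids computing with numerators: it
  is enough to find one admissible substitution with a nonzero result.
\<close>

lemma nonzero_if_rf_subst_to_nonzero:
  assumes "rf_subst_to a b r s" "s \<noteq> 0"
  shows "r \<noteq> 0"
proof
  assume "r = 0"
  then have "s = 0"
    using rf_subst_to_imp_eq[OF assms(1)] rf_subst_to_imp_eq[OF rf_subst_to_0[of a b]] by simp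
  with assms(2) show False ..
qed

lemma rf_const_eq_0_iff [simp]: "rf_const c = 0 \<longleftrightarrow> c = 0"
  by (simp add: rf_const_def)

lemma rf_X_nonzero [simp]: "rf_X \<noteq> 0" and rf_Y_nonzero [simp]: "rf_Y \<noteq> 0"
  by (simp_all add: rf_X_def rf_Y_def)

lemma of_nat_fract_eq_0_iff: "(of_nat m :: 'a::idom fract) = 0 \<longleftrightarrow> (of_nat m :: 'a) = 0"
proof -
  have "(of_nat m :: 'a fract) = to_fract (of_nat m)"
    by (induction m) simp_all
  then show ?thesis
    by simp
qed

lemma of_nat_ratfun_eq_0_iff: "(of_nat m :: 'f::field ratfun) = 0 \<longleftrightarrow> (of_nat m :: 'f) = 0"
  by (simp add: of_nat_fract_eq_0_iff of_nat_poly)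

lemma rf_X_plus_1_nonzero: "rf_X + 1 \<noteq> 0"
proof (rule nonzero_if_rf_subst_to_nonzero)
  show "rf_subst_to 0 0 (rf_X + 1) (0 + 1)"
    by (intro rf_subst_to_intros)
qed simp


section \<open>Birationality\<close>

lemma birational_psi_hat_1_1: "birational (psi_hat_1_1 :: 'f::field ratmap)"
proof (rule birationalI)
  let ?g = "(1 / (rf_X * rf_Y), rf_X) :: 'f ratmap"
  show "rm_comp_ok psi_hat_1_1 ?g \<and> psi_hat_1_1 \<circ>\<^sub>r ?g = (rf_X, rf_Y)"
    unfolding psi_hat_1_1_def Let_def
    by (rule rm_compI, (rule rf_subst_to_intros | simp)+)
  show "rm_comp_ok ?g psi_hat_1_1 \<and> ?g \<circ>\<^sub>r psi_hat_1_1 = (rf_X, rf_Y)"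
    unfolding psi_hat_1_1_def Let_def
    by (rule rm_compI, (rule rf_subst_to_intros | simp)+)
qed

lemma birational_phi_hat_1_1: "birational (phi_hat_1_1 :: 'f::field ratmap)"
proof (rule birationalI)
  let ?g = "(rf_Y / rf_X, rf_X) :: 'f ratmap"
  show "rm_comp_ok phi_hat_1_1 ?g \<and> phi_hat_1_1 \<circ>\<^sub>r ?g = (rf_X, rf_Y)"
    unfolding phi_hat_1_1_def Let_def
    by (rule rm_compI, (rule rf_subst_to_intros | simp)+)
  show "rm_comp_ok ?g phi_hat_1_1 \<and> ?g \<circ>\<^sub>r phi_hat_1_1 = (rf_X, rf_Y)"
    unfolding phi_hat_1_1_def Let_def
    by (rule rm_compI, (rule rf_subst_to_intros | simp)+)
qed

lemma phi_Q_P_involution: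
  "rm_comp_ok (phi_Q_P :: 'f::field ratmap) phi_Q_P \<and>
    (phi_Q_P :: 'f ratmap) \<circ>\<^sub>r phi_Q_P = (rf_X, rf_Y)"
  unfolding phi_Q_P_def Let_def
  by (rule rm_compI, (rule rf_subst_to_intros | simp)+)

lemma birational_phi_Q_P: "birational phi_Q_P"
  by (rule birationalI[OF phi_Q_P_involution phi_Q_P_involution])

lemma phi_5_6b_involution:
  "rm_comp_ok (phi_5_6b :: 'f::field ratmap) phi_5_6b \<and>
    (phi_5_6b :: 'f ratmap) \<circ>\<^sub>r phi_5_6b = (rf_X, rf_Y)"
  unfolding phi_5_6b_def Let_def
  by (rule rm_compI, (rule rf_subst_to_intros | simp)+)

lemma birational_phi_5_6b: "birational phi_5_6b"
  by (rule birationalI[OF phi_5_6b_involution phi_5_6b_involution])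

lemma birational_phi_5_5b: "birational phi_5_5b"
  using birational_phi_5_6b by (simp add: phi_5_5b_def phi_5_6b_def)

text \<open>
  The hypothesis on \<open>h\<close> expresses that \<open>h\<close> depends on the second variable only: substituting anything
  for the first one leaves it unchanged.
\<close>

lemma birational_shear:
  fixes h :: "'f::field ratfun"
  assumes h: "\<And>x. rf_subst_to x rf_Y h h"
  shows "birational (rf_X + h, rf_Y)"
proof (rule birationalI)
  show "rm_comp_ok (rf_X + h, rf_Y) (rf_X - h, rf_Y) \<and>
    (rf_X + h, rf_Y) \<circ>\<^sub>r (rf_X - h, rf_Y) = (rf_X, rf_Y)"
    by (rule rm_compI, (rule rf_subst_to_intros h | simp)+)
  show "rm_comp_ok (rf_X - h, rf_Y) (rf_X + h, rf_Y) \<and>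
    (rf_X - h, rf_Y) \<circ>\<^sub>r (rf_X + h, rf_Y) = (rf_X, rf_Y)"
    by (rule rm_compI, (rule rf_subst_to_intros h | simp)+)
qed

text \<open>
  The inverse is found by solving \<open>Q = 1/(u - h(v))\<close> for \<open>u\<close>.
\<close>

lemma birational_inverted_shear:
  fixes h :: "'f::field ratfun"
  assumes h: "\<And>x. rf_subst_to x rf_Y h h"
  shows "birational (1 / (rf_X - h), rf_Y)"
proof (rule birationalI)
  \<comment> \<open>The substitution \<open>u = h + 1\<close> takes the denominator to \<open>1\<close>.\<close>
  have "rf_subst_to (h + 1) rf_Y (rf_X - h) (h + 1 - h)"
    by (intro rf_subst_to_intros h)
  then have nz: "rf_X - h \<noteq> 0"
    by (rule nonzero_if_rf_subst_to_nonzero) simp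
  show "rm_comp_ok (1 / (rf_X - h), rf_Y) (1 / rf_X + h, rf_Y) \<and>
    (1 / (rf_X - h), rf_Y) \<circ>\<^sub>r (1 / rf_X + h, rf_Y) = (rf_X, rf_Y)"
    by (rule rm_compI, (rule rf_subst_to_intros h | simp)+)
  show "rm_comp_ok (1 / rf_X + h, rf_Y) (1 / (rf_X - h), rf_Y) \<and>
    (1 / rf_X + h, rf_Y) \<circ>\<^sub>r (1 / (rf_X - h), rf_Y) = (rf_X, rf_Y)"
    using nz by - (rule rm_compI, (rule rf_subst_to_intros h | simp)+)
qed

text \<open>
  The part free of \<open>u\<close> in the first component of \<open>Phi_5_10b\<close>. The argument \<open>v\<close> is an arbitrary rational
  function because the composition needs the shift at \<open>1/(U V)\<close> as well as at the second variable.
\<close>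

definition shift :: "nat \<Rightarrow> nat \<Rightarrow> 'f::field \<Rightarrow> 'f \<Rightarrow> 'f ratfun \<Rightarrow> 'f ratfun" where
  "shift N n a t v =
     (- rf_const a - of_nat n + 2 * of_nat N + rf_const t + 1) / (rf_const t * v)
     + of_nat N / (rf_const t * v ^ 2)"

lemma rf_subst_to_shift:
  assumes "t \<noteq> 0" "b \<noteq> 0"
  shows "rf_subst_to x b (shift N n a t rf_Y) (shift N n a t b)"
  unfolding shift_def using assms by (intro rf_subst_to_intros) simp_all

lemma Phi_5_10b_eq_shear:
  assumes "t \<noteq> 0"
  shows "Phi_5_10b N n a t = (rf_X + shift N n a t rf_Y, rf_Y)"
  using assms by (simp add: Phi_5_10b_def shift_def Let_def field_simps power2_eq_square)

text \<open>
  The coefficients \<open>\<alpha> + n - 2 N - t - 1\<close> and \<open>- N\<close> in \<open>Phi_5_4b\<close> are the negatives of those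
  in \<open>Phi_5_10b\<close>, hence the same shift occurs with the opposite sign.
\<close>

lemma Phi_5_4b_eq_inverted_shear:
  assumes t: "t \<noteq> 0"
  shows "Phi_5_4b N n a t = (1 / (rf_X - shift N n a t rf_Y), rf_Y)"
proof -
  have "rf_Y * (rf_const a + of_nat n - 2 * of_nat N + rf_const t * rf_X * rf_Y - rf_const t - 1)
      - of_nat N = rf_const t * rf_Y ^ 2 * (rf_X - shift N n a t rf_Y)"
    using t by (simp add: shift_def field_simps power2_eq_square)
  then show ?thesis
    using t by (simp add: Phi_5_4b_def Let_def)
qed

lemma birational_Phi_5_10b: "t \<noteq> 0 \<Longrightarrow> birational (Phi_5_10b N n a t)"
  unfolding Phi_5_10b_eq_shear by (rule birational_shear) (simp add: rf_subst_to_shift)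

lemma birational_Phi_5_4b: "t \<noteq> 0 \<Longrightarrow> birational (Phi_5_4b N n a t)"
  unfolding Phi_5_4b_eq_inverted_shear
  by (rule birational_inverted_shear) (simp add: rf_subst_to_shift)


section \<open>The composition\<close>

lemma phi_hat_1_1_decomposition:
  fixes t a :: "'f::field"
  assumes t: "t \<noteq> 0"
  shows "phi_hat_1_1 =
    phi_Q_P \<circ>\<^sub>r Phi_5_4b N n a t \<circ>\<^sub>r phi_5_5b \<circ>\<^sub>r phi_5_6b \<circ>\<^sub>r Phi_5_10b N n a t \<circ>\<^sub>r psi_hat_1_1"
proof -
  define V where "V = (rf_Y :: 'f ratfun)"
  define v where "v = 1 / (rf_X * V)"
  \<comment> \<open>\<open>w\<close> is the sheared coordinate; it is unchanged by \<open>phi_5_5b\<close> after \<open>phi_5_6b\<close>.\<close>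
  define w where "w = V + shift N n a t v"
  have nz: "V \<noteq> 0" "v \<noteq> 0"
    by (simp_all add: V_def v_def)
  note shift = rf_subst_to_shift[OF t nz(2)]
  have psi: "psi_hat_1_1 = (V, v)"
    by (simp add: psi_hat_1_1_def v_def V_def)
  have Phi_10b: "Phi_5_10b N n a t \<circ>\<^sub>r (V, v) = (w, v)"
    unfolding Phi_5_10b_eq_shear[OF t]
    by (rule rm_compI[THEN conjunct2], (rule rf_subst_to_intros shift | simp add: w_def)+)
  have phi_6b: "phi_5_6b \<circ>\<^sub>r (w, v) = (w * v, 1 / v)"
    unfolding phi_5_6b_def Let_def using nz
    by - (rule rm_compI[THEN conjunct2], (rule rf_subst_to_intros | simp)+)
  have phi_5b: "phi_5_5b \<circ>\<^sub>r (w * v, 1 / v) = (w, v)"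
    unfolding phi_5_5b_def Let_def using nz
    by - (rule rm_compI[THEN conjunct2], (rule rf_subst_to_intros | simp)+)
  have Phi_4b: "Phi_5_4b N n a t \<circ>\<^sub>r (w, v) = (1 / V, v)"
    unfolding Phi_5_4b_eq_inverted_shear[OF t] using nz
    by - (rule rm_compI[THEN conjunct2], (rule rf_subst_to_intros shift | simp add: w_def)+)
  have phi_QP: "phi_Q_P \<circ>\<^sub>r (1 / V, v) = (V, rf_X * V)"
    unfolding phi_Q_P_def Let_def using nz
    by - (rule rm_compI[THEN conjunct2], (rule rf_subst_to_intros | simp add: v_def)+)
  show ?thesis
    unfolding psi Phi_10b phi_6b phi_5b Phi_4b phi_QP by (simp add: phi_hat_1_1_def V_def)
qed


section \<open>Derivatives\<close>

lemma derivation_mult: "derivation d \<Longrightarrow> d (x * y) = d x * y + x * d y"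
  by (simp add: derivation_def)

lemma derivation_1: "derivation d \<Longrightarrow> d 1 = 0"
  using derivation_mult[of d 1 1] by simp

lemma derivation_0: "derivation d \<Longrightarrow> d 0 = 0"
  using derivation_mult[of d 0 0] by simp

text \<open>
  Differentiate \<open>x \<cdot> (1/x) = 1\<close>. So a derivation of a field obeys the quotient rule however it was
  constructed, and the representation by fractions is only needed for the values at the
  two variables.
\<close>

lemma derivation_inverse:
  fixes x :: "'a::field"
  assumes "derivation d" "x \<noteq> 0"
  shows "d (1 / x) = - d x / x ^ 2"
proof -
  have "d x * (1 / x) + x * d (1 / x) = 0"
    using derivation_mult[OF assms(1), of x "1 / x"] derivation_1[OF assms(1)] assms(2) by simp
  then show ?thesis
    using assms(2) by (simp add: field_simps power2_eq_square eq_neg_iff_add_eq_0)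
qed

lemma fract_deriv_to_fract:
  assumes "derivation d"
  shows "fract_deriv d (to_fract p) = to_fract (d p)"
  using fract_deriv_Fract[of d 1 p] derivation_1[OF assms] derivation_mult[OF assms]
  by (simp add: to_fract_def)

lemma rf_dX_gens [simp]: "rf_dX rf_X = 1" "rf_dX rf_Y = 0"
  by (simp_all add: rf_dX_def rf_X_def rf_Y_def fract_deriv_to_fract derivation_map_poly
      derivation_pderiv map_poly_pCons pderiv_pCons derivation_0 derivation_1 flip: one_pCons)

lemma rf_dY_gens [simp]: "rf_dY rf_X = 0" "rf_dY rf_Y = 1"
  by (simp_all add: rf_dY_def rf_X_def rf_Y_def fract_deriv_to_fract derivation_pderiv pderiv_pCons
      flip: one_pCons)

lemma rf_dt_gens [simp]: "rf_dt rf_X = 0" "rf_dt rf_Y = 0"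
proof -
  have d: "derivation fract_dt"
    unfolding fract_dt_def by (intro derivation_fract_deriv derivation_pderiv)
  show "rf_dt rf_X = 0" "rf_dt rf_Y = 0"
    by (simp_all add: rf_dt_def rf_X_def rf_Y_def fract_deriv_to_fract derivation_map_poly
        d derivation_0[OF d] derivation_1[OF d] map_poly_pCons one_pCons)
qed

lemmas partials_rules =
  derivation_partials[THEN derivation_mult] derivation_partials[THEN derivation_inverse]

lemma partials_psi:
  "rf_dX (1 / (rf_X * rf_Y)) = - 1 / (rf_X ^ 2 * rf_Y)"
  "rf_dY (1 / (rf_X * rf_Y)) = - 1 / (rf_X * rf_Y ^ 2)"
  "rf_dt (1 / (rf_X * rf_Y)) = 0"
  by (simp_all add: partials_rules field_simps power2_eq_square)


section \<open>Transformation of the system\<close>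

text \<open>
  The computational content of the transformation, in an arbitrary field. With \<open>v = 1/(U V)\<close>, the
  derivative of \<open>v\<close> is \<open>- U'/(U\<^sup>2 V) - V'/(U V\<^sup>2)\<close>, and the second identity says that the
  right-hand side of the old equation for \<open>v'\<close> has this value when \<open>U'\<close>, \<open>V'\<close> are given by the
  new system.
\<close>

lemma sys_5_10b_at_psi:
  fixes N n \<alpha> t U V :: "'a::field"
  assumes nz: "N \<noteq> 0" "t \<noteq> 0" "U \<noteq> 0" "V \<noteq> 0" "U + 1 \<noteq> 0"
  defines "v \<equiv> 1 / (U * V)"
    and "G\<^sub>1 \<equiv> (U * (- \<alpha> - n + 2 * N + t + 2) - U^2 * (n - 2 * N * V) + t) / t"
    and "G\<^sub>2 \<equiv> (N * V * (U * (U + 2) * (n - N * V) + \<alpha> + n - 2 * N - 2) + (N + 1) * (- \<alpha> + N + 1))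
        / (N * t * (U + 1))"
  shows "(V * (2 * n * N * v - N^2 + (N + 1) * v^2 * (- \<alpha> + N + 1))
          + N * V^2 * v * (v * (\<alpha> + n - 2 * N - 2) - 2 * N) + n * N)
        / (N * t * v * (V * v + 1)) = G\<^sub>2" (is ?first)
    and "- ((N^2 + v^2 * ((N + 1) * (- \<alpha> + N + 1) + 2 * N * t * V)
            + N * t * V^2 * v^3 + N * v * (- \<alpha> + 2 * N + t + 2))
          / (N * t * (V * v + 1))) = - (G\<^sub>1 / (U ^ 2 * V)) - G\<^sub>2 / (U * V ^ 2)" (is ?second)
proof -
  \<comment> \<open>The singular factor \<open>u v + 1\<close> of the old system becomes that of the new system, up to \<open>1/U\<close>.\<close>
  have v: "V * v + 1 = (U + 1) / U"
    using nz by (simp add: v_def field_simps)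
  show ?first
    unfolding v unfolding v_def G\<^sub>2_def using nz
    by (simp add: divide_simps power2_eq_square) algebra
  show ?second
    unfolding v unfolding v_def G\<^sub>1_def G\<^sub>2_def using nz
    by (simp add: divide_simps power2_eq_square power3_eq_cube) algebra
qed

lemma sys_5_10b_comp_psi:
  fixes t a :: "'f::field"
  assumes t: "t \<noteq> 0" and N: "(of_nat N :: 'f) \<noteq> 0"
  shows "rm_comp_ok (sys_5_10b N n a t) psi_hat_1_1 \<and>
    sys_5_10b N n a t \<circ>\<^sub>r psi_hat_1_1 =
      (snd (sys_1_1 N n a t),
       - (fst (sys_1_1 N n a t) / (rf_X ^ 2 * rf_Y)) - snd (sys_1_1 N n a t) / (rf_X * rf_Y ^ 2))"
proof -
  have N0: "(of_nat N :: 'f ratfun) \<noteq> 0"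
    using N by (simp add: of_nat_ratfun_eq_0_iff)
  have t0: "rf_const t \<noteq> 0"
    using t by simp
  have "rf_Y * (1 / (rf_X * rf_Y)) + 1 = (rf_X + 1 :: 'f ratfun) / rf_X"
    by (simp add: field_simps)
  then have nz: "rf_Y * (1 / (rf_X * rf_Y)) + 1 \<noteq> (0 :: 'f ratfun)"
    using rf_X_plus_1_nonzero by simp
  show ?thesis
    unfolding sys_5_10b_def psi_hat_1_1_def sys_1_1_def Let_def fst_conv snd_conv
    \<comment> \<open>The target equations are resolved first; they fix the form of the substituted
      expressions, which are then derived by the substitution rules.\<close>
    by (rule rm_compI;
        (rule sys_5_10b_at_psi[OF N0 t0 rf_X_nonzero rf_Y_nonzero rf_X_plus_1_nonzero])?)
      ((rule rf_subst_to_intros | (use N0 t0 nz in \<open>simp; fail\<close>))+)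
qed

text \<open>
  Since \<open>u = V\<close>, the first linear equation is already solved for \<open>V'\<close>; in the second one \<open>U'\<close> has the
  nonzero coefficient \<open>- 1/(U\<^sup>2 V)\<close>. So there is exactly one solution \<open>(U', V')\<close>. The map does
  not depend on \<open>t\<close>, so the explicit time derivative contributes nothing.
\<close>

lemma transforms_psi_hat_1_1:
  fixes t a :: "'k::field poly fract"
  assumes t: "t \<noteq> 0" and N: "(of_nat N :: 'k poly fract) \<noteq> 0"
  shows "transforms psi_hat_1_1 (sys_5_10b N n a t) (sys_1_1 N n a t)"
proof -
  let ?F = "sys_5_10b N n a t \<circ>\<^sub>r psi_hat_1_1"
  obtain G1 G2 where G: "sys_1_1 N n a t = (G1, G2)"
    by fastforce
  note comp = sys_5_10b_comp_psi[OF t N, of n a, unfolded G fst_conv snd_conv]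
  have "(rf_dX rf_Y * U' + rf_dY rf_Y * V' + rf_dt rf_Y = fst ?F \<and>
      rf_dX (1 / (rf_X * rf_Y)) * U' + rf_dY (1 / (rf_X * rf_Y)) * V' + rf_dt (1 / (rf_X * rf_Y)) =
      snd ?F) \<longleftrightarrow> (U', V') = (G1, G2)" for U' V'
    using comp by (auto simp: partials_psi field_simps)
  with comp show ?thesis
    by (simp add: transforms_def G psi_hat_1_1_def)
qed

theorem theorem4:
  fixes N n :: nat and \<alpha> :: real
  assumes "N \<ge> 1" and "n \<le> N" and "\<alpha> < 1"
  shows
    "(let a = to_fract [:of_real \<alpha>:] :: 'k::real_field poly fract;
          t = to_fract [:0, 1:] :: 'k poly fract
      in birational (psi_hat_1_1 :: 'k poly fract ratmap) \<and>
         transforms psi_hat_1_1 (sys_5_10b N n a t) (sys_1_1 N n a t)) \<and>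
     (\<forall>t::'k. t \<noteq> 0 \<longrightarrow>
        (let a = of_real \<alpha> :: 'k in
         birational (phi_hat_1_1 :: 'k ratmap) \<and>
         birational (phi_Q_P :: 'k ratmap) \<and>
         birational (Phi_5_4b N n a t) \<and>
         birational (phi_5_5b :: 'k ratmap) \<and>
         birational (phi_5_6b :: 'k ratmap) \<and>
         birational (Phi_5_10b N n a t) \<and>
         birational (psi_hat_1_1 :: 'k ratmap) \<and>
         phi_hat_1_1 =
           phi_Q_P \<circ>\<^sub>r Phi_5_4b N n a t \<circ>\<^sub>r phi_5_5b \<circ>\<^sub>r phi_5_6b \<circ>\<^sub>r Phi_5_10b N n a t \<circ>\<^sub>r psi_hat_1_1))"
proof -
  have N: "(of_nat N :: 'k poly fract) \<noteq> 0"
    using \<open>N \<ge> 1\<close> by (simp add: of_nat_fract_eq_0_iff of_nat_poly)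
  have t': "to_fract [:0, 1:] \<noteq> (0 :: 'k poly fract)"
    by simp
  show ?thesis
    unfolding Let_def
    by (intro conjI allI impI transforms_psi_hat_1_1[OF t' N] phi_hat_1_1_decomposition
        birational_psi_hat_1_1 birational_phi_hat_1_1 birational_phi_Q_P birational_phi_5_5b
        birational_phi_5_6b birational_Phi_5_10b birational_Phi_5_4b)
qed

end
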